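(* Let $K$ be a function field in one variable of characteristic $p>0$ over a field $F$ algebraically closed in $K$. Let $t\in K\setminus F$ be an element which is not a $p$-th power in $K$ and which has at least one simple zero or simple pole (i.e. some prime $\mathfrak{q}$ of $K$ with $\mathrm{ord}_{\mathfrak q}t=\pm1$). Suppose that $p(K,t)=\{x\in K:\exists s\in\mathbb{Z}_{>0},\ x=t^{p^s}\}$ is definable in $K$. Then the structure $\langle \mathbb{Z}_{>0},+,\mid\rangle$ has a model in $K$; specifically, under the bijection $s\mapsto t^{p^s}$ from $\mathbb{Z}_{>0}$ onto $p(K,t)$, the graphs of addition and of divisibility correspond to definable subsets of $K^3$ and $K^2$ respectively.
   Context: "Definable in $K$" means first-order definable in the language of rings with finitely many parameters from $K$. A model of $\langle\mathbb{Z}_{>0},+,\mid\rangle$ in $K$ is a bijection $\phi$ from $\mathbb{Z}_{>0}$ onto a definable subset $D\subseteq K^d$ (some $d\ge1$) such that the images under $\phi$ of the graph of $+$ and of the divisibility relation $\mid$ are definable subsets of $D^3$ and $D^2$ respectively. *)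

theory Defs
  imports "HOL-Computational_Algebra.Polynomial"
begin

definition subfield :: "'k::field set \<Rightarrow> bool" where
  "subfield F \<longleftrightarrow> 0 \<in> F \<and> 1 \<in> F \<and>
     (\<forall>a\<in>F. \<forall>b\<in>F. a + b \<in> F \<and> a * b \<in> F) \<and>
     (\<forall>a\<in>F. - a \<in> F \<and> inverse a \<in> F)"

definition poly_over :: "'k::field set \<Rightarrow> 'k poly \<Rightarrow> bool" where
  "poly_over F q \<longleftrightarrow> set (coeffs q) \<subseteq> F"

definition algebraic_over :: "'k::field set \<Rightarrow> 'k \<Rightarrow> bool" where
  "algebraic_over F x \<longleftrightarrow> (\<exists>q. poly_over F q \<and> q \<noteq> 0 \<and> poly q x = 0)"

definition rat_fun_field :: "'k::field set \<Rightarrow> 'k \<Rightarrow> 'k set" where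
  "rat_fun_field F x = {poly a x / poly b x | a b. poly_over F a \<and> poly_over F b \<and> poly b x \<noteq> 0}"

text \<open>K (the whole type) is a function field in one variable over F: there is an
  element x transcendental over F such that K is a finite-dimensional vector space
  over F(x) (equivalently K/F is finitely generated of transcendence degree 1).\<close>
definition function_field_one_var :: "'k::field set \<Rightarrow> bool" where
  "function_field_one_var F \<longleftrightarrow> subfield F \<and>
     (\<exists>x. \<not> algebraic_over F x \<and>
        (\<exists>B. finite B \<and> (\<forall>y. \<exists>c. (\<forall>b\<in>B. c b \<in> rat_fun_field F x) \<and> y = (\<Sum>b\<in>B. c b * b))))"

definition algebraically_closed_in :: "'k::field set \<Rightarrow> bool" where
  "algebraically_closed_in F \<longleftrightarrow> (\<forall>x. algebraic_over F x \<longrightarrow> x \<in> F)"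

text \<open>Primes of K/F, given by their normalized discrete valuations
  ord_q : K\{0} \<rightarrow> \<int> (surjective), trivial on F. Values at 0 are irrelevant.\<close>
definition prime_valuation :: "'k::field set \<Rightarrow> ('k \<Rightarrow> int) \<Rightarrow> bool" where
  "prime_valuation F v \<longleftrightarrow>
     (\<forall>x y. x \<noteq> 0 \<longrightarrow> y \<noteq> 0 \<longrightarrow> v (x * y) = v x + v y) \<and>
     (\<forall>x y. x \<noteq> 0 \<longrightarrow> y \<noteq> 0 \<longrightarrow> x + y \<noteq> 0 \<longrightarrow> v (x + y) \<ge> min (v x) (v y)) \<and>
     (\<forall>c\<in>F. c \<noteq> 0 \<longrightarrow> v c = 0) \<and>
     (\<forall>n. \<exists>x. x \<noteq> 0 \<and> v x = n)"

datatype 'k rterm = RVar nat | RPar 'k | RZero | ROne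
  | RAdd "'k rterm" "'k rterm" | RNeg "'k rterm" | RMul "'k rterm" "'k rterm"

datatype 'k rform = REq "'k rterm" "'k rterm" | RNot "'k rform"
  | RAnd "'k rform" "'k rform" | REx nat "'k rform"

primrec eval_rterm :: "(nat \<Rightarrow> 'k::comm_ring_1) \<Rightarrow> 'k rterm \<Rightarrow> 'k" where
  "eval_rterm e (RVar i) = e i"
| "eval_rterm e (RPar c) = c"
| "eval_rterm e RZero = 0"
| "eval_rterm e ROne = 1"
| "eval_rterm e (RAdd a b) = eval_rterm e a + eval_rterm e b"
| "eval_rterm e (RNeg a) = - eval_rterm e a"
| "eval_rterm e (RMul a b) = eval_rterm e a * eval_rterm e b"

primrec sat :: "(nat \<Rightarrow> 'k::comm_ring_1) \<Rightarrow> 'k rform \<Rightarrow> bool" where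
  "sat e (REq a b) \<longleftrightarrow> eval_rterm e a = eval_rterm e b"
| "sat e (RNot f) \<longleftrightarrow> \<not> sat e f"
| "sat e (RAnd f g) \<longleftrightarrow> sat e f \<and> sat e g"
| "sat e (REx i f) \<longleftrightarrow> (\<exists>x. sat (e(i := x)) f)"

text \<open>K^d is represented by lists of length d. A subset D of K^d is definable if it is
  the solution set of a formula in the variables 0..d-1 (other variables are set to 0;
  parameters are the finitely many RPar constants occurring in the formula).\<close>
definition list_env :: "'k::comm_ring_1 list \<Rightarrow> nat \<Rightarrow> 'k" where
  "list_env xs i = (if i < length xs then xs ! i else 0)"

definition definable :: "nat \<Rightarrow> 'k::comm_ring_1 list set \<Rightarrow> bool" where
  "definable d D \<longleftrightarrow> (\<exists>\<phi>. D = {xs. length xs = d \<and> sat (list_env xs) \<phi>})"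

definition has_model_Zpos_add_dvd :: "'k::comm_ring_1 itself \<Rightarrow> bool" where
  "has_model_Zpos_add_dvd _ \<longleftrightarrow> (\<exists>d \<ge> 1. \<exists>(\<phi>::nat \<Rightarrow> 'k list) D.
     definable d D \<and> bij_betw \<phi> {n. n > 0} D \<and>
     definable (3 * d) {\<phi> a @ \<phi> b @ \<phi> (a + b) | a b. a > 0 \<and> b > 0} \<and>
     definable (2 * d) {\<phi> a @ \<phi> b | a b. a > 0 \<and> b > 0 \<and> a dvd b})"

end

theory Submission
  imports Defs "HOL-Computational_Algebra.Primes"
begin

text \<open>
  Replacing \<open>t\<close> by its inverse if necessary, \<open>t\<close> has a simple pole for some valuation \<open>v\<close>. Let \<open>A\<close>
  be the definable additive group of all \<open>s ^ p - s\<close>. An element of \<open>A\<close> that has a pole has pole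
  order divisible by \<open>p\<close>, and \<open>x ^ p ^ n - x \<in> A\<close> for all \<open>x\<close>.

  Addition: write \<open>x, y, z\<close> for \<open>t ^ p ^ a, t ^ p ^ b, t ^ p ^ c\<close>. Modulo \<open>A\<close>, \<open>y * z\<close> is
  \<open>t ^ (1 + p ^ |c - b|)\<close>, so comparing pole orders \<open>y * z - t * x \<in> A\<close> iff \<open>|c - b| = a\<close>. Together
  with the condition for \<open>x\<close> and \<open>y\<close> exchanged this says \<open>c = a + b\<close>.

  Frobenius: \<open>w = u ^ p ^ a\<close> iff \<open>w * g ^ p ^ a - u * g \<in> A\<close> for all \<open>g = t ^ p ^ m * t ^ p ^ n\<close>,
  and \<open>g ^ p ^ a\<close> is definable from \<open>t ^ p ^ a\<close> by addition. If all these hold, then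
  \<open>d = w - u ^ p ^ a\<close> has \<open>d * t ^ p ^ m * t ^ p ^ n \<in> A\<close> for all large \<open>m, n\<close>. Letting \<open>n\<close> grow,
  \<open>d * t ^ p ^ m\<close> is a limit of \<open>p\<close>-th powers whose roots have the same property, so its valuation
  is divisible by every power of \<open>p\<close>, hence 0. This cannot be true for two different \<open>m\<close>
  unless \<open>d = 0\<close>.

  Divisibility: \<open>a dvd b\<close> iff \<open>p ^ a - 1\<close> divides \<open>p ^ b - 1\<close> iff \<open>h ^ p ^ a * t = h * t ^ p ^ b\<close>
  for some \<open>h \<noteq> 0\<close>.
\<close>

section \<open>Definable predicates\<close>

text \<open>Arity-free counterpart of \<open>definable\<close>: environments are arbitrary instead
  of padded with zeros, so closure under connectives and quantifiers needs no bookkeeping of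
  dimensions.\<close>

definition definable_pred :: "((nat \<Rightarrow> 'k::comm_ring_1) \<Rightarrow> bool) \<Rightarrow> bool" where
  "definable_pred R \<longleftrightarrow> (\<exists>\<phi>. \<forall>e. sat e \<phi> = R e)"

definition term_fun :: "((nat \<Rightarrow> 'k::comm_ring_1) \<Rightarrow> 'k) \<Rightarrow> bool" where
  "term_fun T \<longleftrightarrow> (\<exists>a. \<forall>e. eval_rterm e a = T e)"

lemma definableI:
  assumes "definable_pred R" "\<And>xs. xs \<in> D \<longleftrightarrow> length xs = d \<and> R (list_env xs)"
  shows "definable d D"
proof -
  obtain \<phi> where "\<And>e. sat e \<phi> = R e" using assms(1) by (auto simp: definable_pred_def)
  with assms(2) show ?thesis unfolding definable_def by (intro exI[of _ \<phi>]) auto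
qed

lemma term_fun_var: "term_fun (\<lambda>e. e i)"
  unfolding term_fun_def by (rule exI[of _ "RVar i"]) simp

lemma term_fun_const: "term_fun (\<lambda>e. c)"
  unfolding term_fun_def by (rule exI[of _ "RPar c"]) simp

lemma term_fun_diff: "term_fun S \<Longrightarrow> term_fun T \<Longrightarrow> term_fun (\<lambda>e. S e - T e)"
  unfolding term_fun_def diff_conv_add_uminus by (metis eval_rterm.simps(5,6))

lemma term_fun_mult: "term_fun S \<Longrightarrow> term_fun T \<Longrightarrow> term_fun (\<lambda>e. S e * T e)"
  unfolding term_fun_def by (metis eval_rterm.simps(7))

lemma term_fun_power: "term_fun S \<Longrightarrow> term_fun (\<lambda>e. S e ^ n)"
  by (induction n) (simp_all add: term_fun_const term_fun_mult)

lemma definable_pred_eq: "term_fun S \<Longrightarrow> term_fun T \<Longrightarrow> definable_pred (\<lambda>e. S e = T e)"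
  unfolding term_fun_def definable_pred_def by (metis sat.simps(1))

lemma definable_pred_not: "definable_pred R \<Longrightarrow> definable_pred (\<lambda>e. \<not> R e)"
  unfolding definable_pred_def by (metis sat.simps(2))

lemma definable_pred_conj:
  "definable_pred R \<Longrightarrow> definable_pred S \<Longrightarrow> definable_pred (\<lambda>e. R e \<and> S e)"
  unfolding definable_pred_def by (metis sat.simps(3))

lemma definable_pred_disj:
  "definable_pred R \<Longrightarrow> definable_pred S \<Longrightarrow> definable_pred (\<lambda>e. R e \<or> S e)"
  using definable_pred_not[OF definable_pred_conj[OF definable_pred_not definable_pred_not], of R S]
  by simp

lemma definable_pred_imp:
  "definable_pred R \<Longrightarrow> definable_pred S \<Longrightarrow> definable_pred (\<lambda>e. R e \<longrightarrow> S e)"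
  unfolding imp_conv_disj by (intro definable_pred_disj definable_pred_not)

lemma definable_pred_ex_upd:
  "definable_pred R \<Longrightarrow> definable_pred (\<lambda>e. \<exists>x. R (e(i := x)))"
  unfolding definable_pred_def by (metis sat.simps(4))

section \<open>Renaming of variables and finite dependence\<close>

primrec rename_rterm :: "(nat \<Rightarrow> nat) \<Rightarrow> 'k rterm \<Rightarrow> 'k rterm" where
  "rename_rterm f (RVar i) = RVar (f i)"
| "rename_rterm f (RPar c) = RPar c"
| "rename_rterm f RZero = RZero"
| "rename_rterm f ROne = ROne"
| "rename_rterm f (RAdd a b) = RAdd (rename_rterm f a) (rename_rterm f b)"
| "rename_rterm f (RNeg a) = RNeg (rename_rterm f a)"
| "rename_rterm f (RMul a b) = RMul (rename_rterm f a) (rename_rterm f b)"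

primrec rename_rform :: "(nat \<Rightarrow> nat) \<Rightarrow> 'k rform \<Rightarrow> 'k rform" where
  "rename_rform f (REq a b) = REq (rename_rterm f a) (rename_rterm f b)"
| "rename_rform f (RNot \<phi>) = RNot (rename_rform f \<phi>)"
| "rename_rform f (RAnd \<phi> \<psi>) = RAnd (rename_rform f \<phi>) (rename_rform f \<psi>)"
| "rename_rform f (REx i \<phi>) = REx (f i) (rename_rform f \<phi>)"

lemma eval_rename_rterm: "eval_rterm e (rename_rterm f a) = eval_rterm (\<lambda>i. e (f i)) a"
  by (induction a) simp_all

text \<open>Bound variables are renamed along with the free ones; injectivity of \<open>f\<close>
  prevents capture.\<close>

lemma sat_rename_rform:
  assumes "inj f"
  shows "sat e (rename_rform f \<phi>) = sat (\<lambda>i. e (f i)) \<phi>"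
proof (induction \<phi> arbitrary: e)
  case (REx i \<phi>)
  have "(\<lambda>j. (e(f i := x)) (f j)) = (\<lambda>j. e (f j))(i := x)" for x
    using assms by (auto simp: fun_eq_iff inj_eq)
  then show ?case using REx by simp
qed (simp_all add: eval_rename_rterm)

lemma definable_pred_rename:
  assumes "inj f" "definable_pred R"
  shows "definable_pred (\<lambda>e. R (\<lambda>i. e (f i)))"
  using assms(2) sat_rename_rform[OF assms(1)] unfolding definable_pred_def by metis

lemma eval_rterm_cong_finite:
  "\<exists>m. \<forall>e e'. (\<forall>i<m. e i = e' i) \<longrightarrow> eval_rterm e a = eval_rterm e' a"
proof (induction a)
  case (RVar i)
  then show ?case by (auto intro!: exI[of _ "Suc i"])
next
  case (RAdd a b)
  then obtain m n where
    "\<And>e e'. (\<forall>i<m. e i = e' i) \<Longrightarrow> eval_rterm e a = eval_rterm e' a"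
    "\<And>e e'. (\<forall>i<n. e i = e' i) \<Longrightarrow> eval_rterm e b = eval_rterm e' b" by blast
  then have "eval_rterm e a = eval_rterm e' a" "eval_rterm e b = eval_rterm e' b"
    if "\<forall>i<max m n. e i = e' i" for e e'
    using that by (simp_all add: less_max_iff_disj)
  then show ?case
    unfolding eval_rterm.simps(5) by (intro exI[of _ "max m n"] allI impI) metis
next
  case (RMul a b)
  then obtain m n where
    "\<And>e e'. (\<forall>i<m. e i = e' i) \<Longrightarrow> eval_rterm e a = eval_rterm e' a"
    "\<And>e e'. (\<forall>i<n. e i = e' i) \<Longrightarrow> eval_rterm e b = eval_rterm e' b" by blast
  then have "eval_rterm e a = eval_rterm e' a" "eval_rterm e b = eval_rterm e' b"
    if "\<forall>i<max m n. e i = e' i" for e e'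
    using that by (simp_all add: less_max_iff_disj)
  then show ?case
    unfolding eval_rterm.simps(7) by (intro exI[of _ "max m n"] allI impI) metis
next
  case (RNeg a)
  then show ?case by simp
qed simp_all

text \<open>A formula mentions only finitely many variables, so a variable beyond the bound is
  available to hold a witness.\<close>

lemma sat_cong_finite:
  "\<exists>m. \<forall>e e'. (\<forall>i<m. e i = e' i) \<longrightarrow> sat e \<phi> = sat e' \<phi>"
proof (induction \<phi>)
  case (REq a b)
  obtain m n where
    "\<And>e e'. (\<forall>i<m. e i = e' i) \<Longrightarrow> eval_rterm e a = eval_rterm e' a"
    "\<And>e e'. (\<forall>i<n. e i = e' i) \<Longrightarrow> eval_rterm e b = eval_rterm e' b"
    using eval_rterm_cong_finite[of a] eval_rterm_cong_finite[of b] by blast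
  then have "eval_rterm e a = eval_rterm e' a" "eval_rterm e b = eval_rterm e' b"
    if "\<forall>i<max m n. e i = e' i" for e e'
    using that by (simp_all add: less_max_iff_disj)
  then show ?case
    unfolding sat.simps(1) by (intro exI[of _ "max m n"] allI impI) metis
next
  case (RAnd a b)
  then obtain m n where
    "\<And>e e'. (\<forall>i<m. e i = e' i) \<Longrightarrow> sat e a = sat e' a"
    "\<And>e e'. (\<forall>i<n. e i = e' i) \<Longrightarrow> sat e b = sat e' b" by blast
  then have "sat e a = sat e' a" "sat e b = sat e' b" if "\<forall>i<max m n. e i = e' i" for e e'
    using that by (simp_all add: less_max_iff_disj)
  then show ?case
    unfolding sat.simps(3) by (intro exI[of _ "max m n"] allI impI) metis
next
  case (REx i \<phi>)
  then obtain m where m: "\<And>e e'. (\<forall>i<m. e i = e' i) \<Longrightarrow> sat e \<phi> = sat e' \<phi>" by blast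
  have "sat (e(i := x)) \<phi> = sat (e'(i := x)) \<phi>" if "\<forall>i<m. e i = e' i" for e e' x
    using that by (intro m) simp
  then show ?case by (auto intro!: exI[of _ m])
qed simp

lemma definable_pred_cong_finite:
  assumes "definable_pred R"
  obtains m where "\<And>e e'. (\<And>i. i < m \<Longrightarrow> e i = e' i) \<Longrightarrow> R e = R e'"
  using assms sat_cong_finite unfolding definable_pred_def by metis

text \<open>Quantified variables are handled in de Bruijn style: the bound variable becomes variable 0
  and the others are shifted.\<close>

lemma definable_pred_ex:
  assumes "definable_pred (\<lambda>e. Q (\<lambda>i. e (Suc i)) (e 0))"
  shows "definable_pred (\<lambda>e. \<exists>x. Q e x)"
proof -
  let ?S = "\<lambda>e. Q (\<lambda>i. e (Suc i)) (e 0)"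
  obtain m where m: "\<And>e e'. (\<And>i. i < m \<Longrightarrow> e i = e' i) \<Longrightarrow> ?S e = ?S e'"
    using definable_pred_cong_finite[OF assms] by blast
  \<comment> \<open>Variable \<open>m\<close> receives the witness, since \<open>?S\<close> does not
    depend on indices from \<open>m\<close> on. Larger free indices skip \<open>m\<close> only to
    keep \<open>f\<close> injective.\<close>
  define f where "f = case_nat m (\<lambda>i. if i < m then i else Suc i)"
  have "inj f"
    by (auto simp: inj_on_def f_def split: nat.splits if_splits)
  have "?S (\<lambda>i. (e(m := x)) (f i)) = ?S (case_nat x e)" for e x
    by (rule m) (auto simp: f_def split: nat.splits)
  then have "(\<lambda>e. \<exists>x. Q e x) = (\<lambda>e. \<exists>x. ?S (\<lambda>i. (e(m := x)) (f i)))"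
    by simp
  then show ?thesis
    using definable_pred_ex_upd[OF definable_pred_rename[OF \<open>inj f\<close> assms], of m] by simp
qed

lemma definable_pred_all:
  assumes "definable_pred (\<lambda>e. Q (\<lambda>i. e (Suc i)) (e 0))"
  shows "definable_pred (\<lambda>e. \<forall>x. Q e x)"
  using definable_pred_not[OF definable_pred_ex[OF definable_pred_not[OF assms]]] by simp

lemmas definable_intros = definable_pred_eq definable_pred_not definable_pred_conj
  definable_pred_disj definable_pred_imp definable_pred_ex definable_pred_all
  term_fun_var term_fun_const term_fun_diff term_fun_mult term_fun_power

text \<open>When \<open>G\<close> is the graph of a function, this is \<open>R\<close> with variable
  \<open>i\<close> replaced by its image. It is applied to the zero function and to
  inversion.\<close>

lemma definable_pred_subst:
  assumes "definable_pred R" "definable_pred (\<lambda>e. G (e 0) (e (Suc i)))"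
  shows "definable_pred (\<lambda>e. \<exists>x. G x (e i) \<and> R (e(i := x)))"
proof (intro definable_pred_ex definable_pred_conj assms(2))
  define f where "f = (\<lambda>j. if j = i then 0 else Suc j)"
  have "inj f" by (auto simp: inj_on_def f_def split: if_splits)
  have "(\<lambda>j. e (Suc j))(i := e 0) = (\<lambda>j. e (f j))" for e :: "nat \<Rightarrow> 'a"
    by (auto simp: f_def)
  then show "definable_pred (\<lambda>e. R ((\<lambda>j. e (Suc j))(i := e 0)))"
    using definable_pred_rename[OF \<open>inj f\<close> assms(1)] by simp
qed

lemma definable_pred_mem:
  assumes "definable 1 D"
  shows "definable_pred (\<lambda>e. [e i] \<in> D)"
proof -
  obtain \<phi> where D: "D = {xs. length xs = 1 \<and> sat (list_env xs) \<phi>}"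
    using assms by (auto simp: definable_def)
  have "definable_pred (\<lambda>e. sat e \<phi>)" by (auto simp: definable_pred_def)
  then obtain m where m: "\<And>e e'. (\<And>i. i < m \<Longrightarrow> e i = e' i) \<Longrightarrow> sat e \<phi> = sat e' \<phi>"
    using definable_pred_cong_finite by blast
  \<comment> \<open>\<open>\<phi>\<close> describes \<open>D\<close> only where all variables except
    0 vanish, so these are set to 0 one by one, as far as the formula can see.\<close>
  have "definable_pred (\<lambda>e. sat (\<lambda>j. if 0 < j \<and> j \<le> k then 0 else e j) \<phi>)" for k
  proof (induction k)
    case 0
    have "(\<lambda>j. if 0 < j \<and> j \<le> 0 then 0 else e j) = e" for e :: "nat \<Rightarrow> 'a"
      by (auto simp: fun_eq_iff)
    then show ?case using \<open>definable_pred (\<lambda>e. sat e \<phi>)\<close> by simp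
  next
    case (Suc k)
    have "(\<lambda>j. if 0 < j \<and> j \<le> k then 0 else (e(Suc k := 0)) j)
        = (\<lambda>j. if 0 < j \<and> j \<le> Suc k then 0 else e j)" for e :: "nat \<Rightarrow> 'a"
      by (auto simp: fun_eq_iff)
    moreover have "definable_pred (\<lambda>e. e 0 = (0::'a))" by (intro definable_intros)
    ultimately show ?case
      using definable_pred_subst[OF Suc, of "\<lambda>x y. x = 0" "Suc k"] by simp
  qed
  from this[of m] have *: "definable_pred (\<lambda>e. sat (list_env [e 0]) \<phi>)"
    by (rule back_subst[of definable_pred]) (auto intro!: m simp: list_env_def)
  \<comment> \<open>The transposition of 0 and \<open>i\<close> moves the tested variable to
    position \<open>i\<close>.\<close>
  have "inj (\<lambda>j. if j = 0 then i else if j = i then 0 else j)"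
    by (auto simp: inj_on_def)
  from definable_pred_rename[OF this *] show ?thesis by (simp add: D)
qed

text \<open>Allows a simple zero of \<open>t\<close> to be treated as a simple pole of
  \<open>inverse t\<close>.\<close>

lemma definable_inverse:
  fixes D :: "'k::field list set"
  assumes "definable d D"
  shows "definable d {xs. map inverse xs \<in> D}"
proof -
  obtain \<phi> where D: "D = {xs. length xs = d \<and> sat (list_env xs) \<phi>}"
    using assms by (auto simp: definable_def)
  have "definable_pred (\<lambda>e. sat (\<lambda>j. if j < k then inverse (e j) else e j) \<phi>)" for k
  proof (induction k)
    case 0
    show ?case by (auto simp: definable_pred_def)
  next
    case (Suc k)
    have "(\<lambda>j. if j < k then inverse ((e(k := inverse (e k))) j) else (e(k := inverse (e k))) j)
        = (\<lambda>j. if j < Suc k then inverse (e j) else e j)" for e :: "nat \<Rightarrow> 'k"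
      by (auto simp: fun_eq_iff less_Suc_eq)
    \<comment> \<open>The convention \<open>inverse 0 = 0\<close> adds the origin to the graph of
      inversion.\<close>
    moreover have "(x = 0 \<and> y = 0 \<or> x * y = 1) \<longleftrightarrow> x = inverse y" for x y :: 'k
      by (metis inverse_unique inverse_zero left_inverse mult.commute)
    moreover have "definable_pred (\<lambda>e. e 0 = 0 \<and> e (Suc k) = 0 \<or> e 0 * e (Suc k) = (1::'k))"
      by (intro definable_intros)
    ultimately show ?case
      using definable_pred_subst[OF Suc, of "\<lambda>x y. x = 0 \<and> y = 0 \<or> x * y = 1" k]
      by simp
  qed
  from this[of d] show ?thesis
  proof (rule definableI)
    fix xs :: "'k list"
    have "list_env (map inverse xs) =
        (\<lambda>j. if j < d then inverse (list_env xs j) else list_env xs j)" if "length xs = d"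
      using that by (auto simp: list_env_def)
    then show "xs \<in> {xs. map inverse xs \<in> D} \<longleftrightarrow> length xs = d \<and>
        sat (\<lambda>j. if j < d then inverse (list_env xs j) else list_env xs j) \<phi>"
      by (auto simp: D)
  qed
qed

section \<open>Fields with a valuation at which \<open>t\<close> has a simple pole\<close>

locale simple_pole =
  fixes v :: "'k::field \<Rightarrow> int" and t :: 'k and p :: nat
  assumes CHAR_eq: "CHAR('k) = p" and prime_p: "prime p"
    and v_mult: "x \<noteq> 0 \<Longrightarrow> y \<noteq> 0 \<Longrightarrow> v (x * y) = v x + v y"
    and v_add: "x \<noteq> 0 \<Longrightarrow> y \<noteq> 0 \<Longrightarrow> x + y \<noteq> 0 \<Longrightarrow> min (v x) (v y) \<le> v (x + y)"
    and t_nonzero: "t \<noteq> 0" and v_t: "v t = - 1"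
begin

section \<open>Valuation arithmetic\<close>

lemma p_ge_2: "p \<ge> 2"
  using prime_p by (rule prime_ge_2_nat)

lemma v_one: "v 1 = 0"
  using v_mult[of 1 1] by simp

lemma v_minus: "v (- x) = v x"
proof (cases "x = 0")
  case False
  have "v (-1) = 0" using v_mult[of "-1" "-1"] v_one by simp
  then show ?thesis using v_mult[of "-1" x] False by simp
qed simp

lemma v_power: "x \<noteq> 0 \<Longrightarrow> v (x ^ n) = int n * v x"
  by (induction n) (simp_all add: v_one v_mult algebra_simps)

lemma v_t_power: "v (t ^ n) = - int n"
  by (simp add: v_power t_nonzero v_t)

lemma inj_t_power: "inj (\<lambda>s. t ^ p ^ s)"
proof (rule injI)
  fix a b :: nat assume "t ^ p ^ a = t ^ p ^ b"
  from arg_cong[OF this, of v] show "a = b"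
    using p_ge_2 by (simp add: v_t_power power_inject_exp)
qed

lemma v_divide: "x \<noteq> 0 \<Longrightarrow> y \<noteq> 0 \<Longrightarrow> v (x / y) = v x - v y"
  using v_mult[of "x / y" y] by simp

text \<open>Equality case of the ultrametric inequality; the reverse bound comes from
  \<open>x = (x + y) - y\<close>. The case \<open>y = 0\<close> is separate because
  \<open>v 0\<close> is arbitrary.\<close>

lemma v_add_dominant:
  assumes "x \<noteq> 0" "y = 0 \<or> v x < v y"
  shows "x + y \<noteq> 0 \<and> v (x + y) = v x"
proof (cases "y = 0")
  case False
  have "x + y \<noteq> 0"
    using assms False v_minus[of y] by (auto simp: add_eq_0_iff2)
  moreover from this have "v (x + y) \<ge> v x"
    using v_add[of x y] assms False by auto
  moreover have "v x \<ge> min (v (x + y)) (v y)"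
    using v_add[of "x + y" "- y"] assms False \<open>x + y \<noteq> 0\<close> by (simp add: v_minus)
  ultimately show ?thesis using assms False by auto
qed (use assms in auto)

definition integral :: "'k \<Rightarrow> bool" where
  "integral x \<longleftrightarrow> x = 0 \<or> 0 \<le> v x"

lemma integral_minus: "integral x \<Longrightarrow> integral (- x)"
  by (simp add: integral_def v_minus)

lemma integral_add: "integral x \<Longrightarrow> integral y \<Longrightarrow> integral (x + y)"
  using v_add[of x y] by (fastforce simp: integral_def)

lemma integral_mult: "integral x \<Longrightarrow> integral y \<Longrightarrow> integral (x * y)"
  by (cases "x = 0"; cases "y = 0") (auto simp: integral_def v_mult)

lemma integral_power: "integral x \<Longrightarrow> integral (x ^ n)"
  by (induction n) (simp_all add: integral_mult, simp add: integral_def v_one)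

lemma frobenius_diff: "(x - y) ^ p ^ n = x ^ p ^ n - (y :: 'k) ^ p ^ n"
  using freshmans_dream'[of "p ^ n" n "x - y" y] prime_p CHAR_eq
  by (simp add: algebra_simps)

section \<open>The Artin-Schreier group\<close>

definition artin_schreier :: "'k set" where
  "artin_schreier = range (\<lambda>s. s ^ p - s)"

lemma artin_schreier_diff:
  assumes "x \<in> artin_schreier" "y \<in> artin_schreier"
  shows "x - y \<in> artin_schreier"
proof -
  obtain r s where "x = r ^ p - r" "y = s ^ p - s"
    using assms by (auto simp: artin_schreier_def)
  then have "x - y = (r - s) ^ p - (r - s)"
    using frobenius_diff[of r s 1] by simp
  then show ?thesis by (auto simp: artin_schreier_def)
qed

lemma artin_schreier_zero: "0 \<in> artin_schreier"
  using prime_gt_0_nat[OF prime_p] by (auto simp: artin_schreier_def intro!: image_eqI[of _ _ 0])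

lemma artin_schreier_cong:
  assumes "x - y \<in> artin_schreier"
  shows "x \<in> artin_schreier \<longleftrightarrow> y \<in> artin_schreier"
  using artin_schreier_diff[OF _ assms, of x]
    artin_schreier_diff[OF assms, of "- y"] artin_schreier_diff[OF artin_schreier_zero, of y]
  by auto

text \<open>Telescoping: the difference is the sum of \<open>y ^ p - y\<close> over
  \<open>y = x ^ p ^ i\<close> with \<open>i < n\<close>.\<close>

lemma artin_schreier_frobenius: "x ^ p ^ n - x \<in> artin_schreier"
proof (induction n)
  case (Suc n)
  have "x ^ p ^ Suc n - x ^ p ^ n \<in> artin_schreier"
    by (auto simp: artin_schreier_def power_mult[symmetric] mult.commute
        intro!: image_eqI[of _ _ "x ^ p ^ n"])
  moreover have "(x ^ p ^ Suc n - x) - (x ^ p ^ n - x) = x ^ p ^ Suc n - x ^ p ^ n" by simp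
  ultimately show ?case using artin_schreier_cong Suc by metis
qed (simp add: artin_schreier_zero)

text \<open>An integral \<open>s\<close> would make \<open>f\<close> integral. So \<open>s\<close>
  has a pole, and \<open>s ^ p\<close> strictly dominates both \<open>s\<close> and the integral
  error. Tolerating that error is what the descent below requires.\<close>

lemma v_artin_schreier_pole:
  assumes "f \<noteq> 0" "v f < 0" "integral (f - (s ^ p - s))"
  shows "s \<noteq> 0 \<and> v f = int p * v s"
proof -
  define r where "r = f - (s ^ p - s)"
  have f: "f = s ^ p + (- s + r)" by (simp add: r_def)
  have "\<not> integral s"
  proof
    assume "integral s"
    then have "integral f"
      unfolding f using assms(3) by (intro integral_add integral_power integral_minus) (auto simp: r_def)
    then show False using assms by (simp add: integral_def)
  qed
  then have s: "s \<noteq> 0" "v s < 0" by (auto simp: integral_def)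
  have "v (- s + r) = v s"
    using v_add_dominant[of "- s" r] assms(3) s by (auto simp: v_minus integral_def r_def)
  moreover have "int p * v s < v s"
    using mult_strict_right_mono_neg[of 1 "int p" "v s"] s p_ge_2 by simp
  ultimately show ?thesis
    using v_add_dominant[of "s ^ p" "- s + r"] s by (simp add: f v_power)
qed

section \<open>Descent along powers of \<open>t\<close>\<close>

text \<open>A relation \<open>d * t ^ p ^ M = s ^ p - s\<close> exhibits \<open>d\<close> as the \<open>p\<close>-th power of
  \<open>r = s / t ^ p ^ (M - 1)\<close> up to an error of valuation about \<open>p ^ M - p ^ (M - 1)\<close>.
  For smaller \<open>n\<close> the error becomes integral in \<open>d * t ^ p ^ n\<close>, so that \<open>r\<close> inherits
  the hypotheses from \<open>d\<close>, with \<open>v d = p * v r\<close>.\<close>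

lemma power_dvd_v_of_artin_schreier_multiples:
  assumes "d \<noteq> 0" "v d \<noteq> 0" "\<bar>v d\<bar> < int p ^ N"
    and "\<And>n. N \<le> n \<Longrightarrow> n \<le> N + 2 * k \<Longrightarrow> \<exists>s. integral (d * t ^ p ^ n - (s ^ p - s))"
  shows "int p ^ k dvd v d"
  using assms
proof (induction k arbitrary: d N)
  case (Suc k)
  have "N \<noteq> 0" using Suc.prems(2,3) by (intro notI) simp
  then obtain N' where N': "N = Suc N'" by (cases N) auto
  \<comment> \<open>\<open>Suc M\<close> is \<open>N + 2 * Suc k\<close>, the last index at which
    the hypothesis is available.\<close>
  define M where "M = N + 2 * k + 1"
  obtain s where s: "integral (d * t ^ p ^ Suc M - (s ^ p - s))"
    using Suc.prems(4)[of "Suc M"] by (auto simp: M_def)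
  have vdt: "v (d * t ^ p ^ Suc M) = v d - int p ^ Suc M"
    using Suc.prems(1) by (simp add: v_mult t_nonzero v_t_power)
  have "int p ^ N \<le> int p ^ Suc M"
    using p_ge_2 by (intro power_increasing) (auto simp: M_def)
  with v_artin_schreier_pole[OF _ _ s] vdt Suc.prems(1,3)
  have vs: "s \<noteq> 0" "v d - int p ^ Suc M = int p * v s"
    by (auto simp: t_nonzero)
  define r where "r = s / t ^ p ^ M"
  have r: "r \<noteq> 0" using vs by (simp add: r_def t_nonzero)
  have "v r = v s + int p ^ M"
    using vs by (simp add: r_def v_divide t_nonzero v_t_power)
  then have vr: "v d = int p * v r"
    using vs by (simp add: algebra_simps)
  \<comment> \<open>Dividing by \<open>p\<close> turns the bound for \<open>d\<close> into one with
    \<open>N' = N - 1\<close>, so the induction hypothesis is used at \<open>N'\<close>.\<close>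
  have "int p * \<bar>v r\<bar> < int p * int p ^ N'"
    using Suc.prems(3) by (simp add: vr abs_mult N')
  then have vr_less: "\<bar>v r\<bar> < int p ^ N'"
    using p_ge_2 by (simp add: mult_less_cancel_left)
  have "int p ^ k dvd v r"
  proof (rule Suc.IH[OF r _ vr_less])
    show "v r \<noteq> 0" using Suc.prems(2) vr by auto
    fix n assume n: "N' \<le> n" "n \<le> N' + 2 * k"
    obtain u where u: "integral (d * t ^ p ^ Suc n - (u ^ p - u))"
      using Suc.prems(4)[of "Suc n"] n by (auto simp: N')
    \<comment> \<open>Multiplying the relation at \<open>Suc M\<close> by \<open>q\<close> moves it
      to exponent \<open>Suc n\<close>: \<open>s ^ p\<close> becomes
      \<open>r ^ p * t ^ p ^ Suc n\<close>, while the linear term \<open>s * q\<close> and the error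
      become integral.\<close>
    define q where "q = t ^ p ^ Suc n / t ^ p ^ Suc M"
    have q: "q \<noteq> 0" "v q = int p ^ Suc M - int p ^ Suc n"
      by (simp_all add: q_def v_divide t_nonzero v_t_power)
    have le1: "int p ^ Suc n \<le> int p ^ (M - 1)" "int p ^ N' \<le> int p ^ (M - 1)"
      using p_ge_2 n by (auto intro!: power_increasing simp: M_def N' simp del: power_Suc)
    have M: "M = Suc (M - 1)" by (simp add: M_def)
    have "2 * int p ^ M \<le> int p ^ Suc M" "2 * int p ^ (M - 1) \<le> int p ^ M"
      using p_ge_2 by (auto intro!: mult_right_mono) (subst M, auto intro!: mult_right_mono)
    \<comment> \<open>Two spare steps in the exponent suffice as \<open>p\<close> is at least 2:
      \<open>int p ^ Suc M\<close> absorbs \<open>int p ^ M\<close>, \<open>int p ^ Suc n\<close>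
      and the bound \<open>int p ^ N'\<close> on \<open>v r\<close>.\<close>
    then have *: "int p ^ M + int p ^ (M - 1) + int p ^ (M - 1) \<le> int p ^ Suc M" by linarith
    have "v (r * t ^ p ^ M * q) = v r - int p ^ M + v q"
      using r q by (simp add: v_mult t_nonzero v_t_power)
    then have "0 \<le> v (r * t ^ p ^ M * q)"
      using * le1 vr_less q by linarith
    then have "integral (r * t ^ p ^ M * q)" by (simp add: integral_def)
    moreover have "0 \<le> int p ^ M" "0 \<le> int p ^ (M - 1)" by simp_all
    then have "0 \<le> v q" using q le1 * by linarith
    then have "integral q" by (simp add: integral_def)
    then have "integral ((d * t ^ p ^ Suc M - (s ^ p - s)) * q)"
      using s by (rule integral_mult[rotated])
    \<comment> \<open>Subtracting the two relations for exponent \<open>Suc n\<close> cancels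
      \<open>d\<close>, leaving only \<open>r\<close> and \<open>u\<close>.\<close>
    ultimately have "integral ((d * t ^ p ^ Suc n - (u ^ p - u)) + (r * t ^ p ^ M * q
        + - ((d * t ^ p ^ Suc M - (s ^ p - s)) * q)))"
      using u by (intro integral_add integral_minus)
    moreover have "s = r * t ^ p ^ M" by (simp add: r_def t_nonzero)
    then have "s ^ p * q = r ^ p * t ^ p ^ Suc n" "t ^ p ^ Suc M * q = t ^ p ^ Suc n"
      by (simp_all add: q_def t_nonzero power_mult_distrib power_mult[symmetric] mult.commute)
    then have "(d * t ^ p ^ Suc n - (u ^ p - u)) + (r * t ^ p ^ M * q
        + - ((d * t ^ p ^ Suc M - (s ^ p - s)) * q)) = r ^ p * t ^ p ^ Suc n - (u ^ p - u)"
      using \<open>s = r * t ^ p ^ M\<close> by (simp add: algebra_simps)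
    ultimately have "integral (r ^ p * t ^ p ^ Suc n - (u ^ p - u))" by metis
    \<comment> \<open>Replacing \<open>u\<close> by \<open>u - r * t ^ p ^ n\<close> trades
      \<open>r ^ p * t ^ p ^ Suc n\<close> for its \<open>p\<close>-th root
      \<open>r * t ^ p ^ n\<close>.\<close>
    moreover have "(u - r * t ^ p ^ n) ^ p = u ^ p - r ^ p * t ^ p ^ Suc n"
      using frobenius_diff[of u "r * t ^ p ^ n" 1]
      by (simp add: power_mult_distrib power_mult[symmetric] mult.commute)
    then have "r * t ^ p ^ n - ((u - r * t ^ p ^ n) ^ p - (u - r * t ^ p ^ n))
        = r ^ p * t ^ p ^ Suc n - (u ^ p - u)"
      by simp
    ultimately have "integral (r * t ^ p ^ n - ((u - r * t ^ p ^ n) ^ p - (u - r * t ^ p ^ n)))"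
      by metis
    then show "\<exists>s. integral (r * t ^ p ^ n - (s ^ p - s))" by blast
  qed
  then show ?case by (simp add: vr)
qed simp

text \<open>The second power of \<open>t\<close> drives the descent, which forces the valuation of
  \<open>d * t ^ p ^ m\<close> to be 0. The first power is there to vary: two values of
  \<open>m\<close> give incompatible values of \<open>v d\<close>.\<close>

lemma eq_zero_of_artin_schreier_multiples:
  assumes "\<And>m n. a < m \<Longrightarrow> a < n \<Longrightarrow> d * t ^ p ^ m * t ^ p ^ n \<in> artin_schreier"
  shows "d = 0"
proof (rule ccontr)
  assume "d \<noteq> 0"
  have "v d = int p ^ m" if "a < m" for m
  proof (rule ccontr)
    define x where "x = d * t ^ p ^ m"
    have x: "x \<noteq> 0" "v x = v d - int p ^ m"
      using \<open>d \<noteq> 0\<close> by (simp_all add: x_def v_mult t_nonzero v_t_power)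
    assume "v d \<noteq> int p ^ m"
    then have "v x \<noteq> 0" by (simp add: x)
    \<comment> \<open>\<open>k\<close> exceeds \<open>a\<close>, so every exponent from
      \<open>k\<close> on is admissible, and it exceeds \<open>\<bar>v x\<bar>\<close>, so
      \<open>int p ^ k\<close> cannot divide a nonzero \<open>v x\<close>.\<close>
    define k where "k = a + 1 + nat \<bar>v x\<bar>"
    have "k < p ^ k" using p_ge_2 by (intro power_gt_expt) auto
    then have "int k < int p ^ k" by (metis of_nat_less_iff of_nat_power)
    then have less: "\<bar>v x\<bar> < int p ^ k" by (simp add: k_def)
    have "int p ^ k dvd v x"
    proof (rule power_dvd_v_of_artin_schreier_multiples[OF x(1) \<open>v x \<noteq> 0\<close> less])
      fix n assume "k \<le> n"
      then have "x * t ^ p ^ n \<in> artin_schreier"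
        unfolding x_def using that by (intro assms) (auto simp: k_def)
      then show "\<exists>s. integral (x * t ^ p ^ n - (s ^ p - s))"
        by (auto simp: artin_schreier_def integral_def)
    qed
    then show False
      using dvd_imp_le_int[OF \<open>v x \<noteq> 0\<close>] less by fastforce
  qed
  from this[of "Suc a"] this[of "Suc (Suc a)"] show False
    using p_ge_2 by simp
qed

section \<open>Frobenius, addition and divisibility as Artin-Schreier conditions\<close>

lemma frobenius_iff_artin_schreier:
  "(\<forall>m>0. \<forall>n>0. w * t ^ p ^ (a + m) * t ^ p ^ (a + n) - u * t ^ p ^ m * t ^ p ^ n \<in> artin_schreier)
    \<longleftrightarrow> w = u ^ p ^ a" (is "?L \<longleftrightarrow> _")
proof -
  have pow: "(u * t ^ p ^ m * t ^ p ^ n) ^ p ^ a = u ^ p ^ a * t ^ p ^ (a + m) * t ^ p ^ (a + n)" for m n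
    by (simp add: power_mult_distrib power_mult[symmetric] power_add mult.commute)
  show ?thesis
  proof
    assume L: ?L
    \<comment> \<open>Both \<open>w\<close> and \<open>u ^ p ^ a\<close> satisfy the relation with
      the same \<open>u\<close>-term, so it cancels. Only exponents above \<open>a\<close> have the
      form \<open>a + m\<close> with \<open>m > 0\<close>.\<close>
    have "(w - u ^ p ^ a) * t ^ p ^ m * t ^ p ^ n \<in> artin_schreier" if "a < m" "a < n" for m n
    proof -
      have "w * t ^ p ^ m * t ^ p ^ n - u * t ^ p ^ (m - a) * t ^ p ^ (n - a) \<in> artin_schreier"
        using L[rule_format, of "m - a" "n - a"] that by simp
      moreover have "u ^ p ^ a * t ^ p ^ m * t ^ p ^ n - u * t ^ p ^ (m - a) * t ^ p ^ (n - a) \<in> artin_schreier"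
        using artin_schreier_frobenius[of "u * t ^ p ^ (m - a) * t ^ p ^ (n - a)" a]
          pow[of "m - a" "n - a"] that by simp
      ultimately show ?thesis
        using artin_schreier_diff by (fastforce simp: algebra_simps)
    qed
    then have "w - u ^ p ^ a = 0" by (rule eq_zero_of_artin_schreier_multiples)
    then show "w = u ^ p ^ a" by simp
  next
    assume "w = u ^ p ^ a"
    then show ?L using artin_schreier_frobenius pow by metis
  qed
qed

text \<open>The larger power dominates, so the difference has pole order \<open>m\<close>.\<close>

lemma t_power_diff_artin_schreier:
  assumes "t ^ m - t ^ n \<in> artin_schreier" "n < m"
  shows "p dvd m"
proof -
  have "t ^ m - t ^ n \<noteq> 0 \<and> v (t ^ m - t ^ n) = - int m"
    using v_add_dominant[of "t ^ m" "- (t ^ n)"] assms(2) by (simp add: v_minus v_t_power t_nonzero)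
  moreover obtain s where "t ^ m - t ^ n = s ^ p - s"
    using assms(1) by (auto simp: artin_schreier_def)
  ultimately have "- int m = int p * v s"
    using v_artin_schreier_pole[of "t ^ m - t ^ n" s] assms(2) by (auto simp: integral_def)
  then have "int p dvd int m" by (metis dvd_minus_iff dvd_triv_left)
  then show ?thesis by simp
qed

lemma shift_iff_artin_schreier:
  assumes "0 < a" "b \<le> c"
  shows "t ^ p ^ b * t ^ p ^ c - t * t ^ p ^ a \<in> artin_schreier \<longleftrightarrow> c = a + b"
proof -
  \<comment> \<open>For \<open>i = 0\<close> and \<open>p = 2\<close> this fails, but below it is
    applied to the larger of two distinct exponents, which is positive.\<close>
  have not_dvd: "\<not> p dvd 1 + p ^ i" if "0 < i" for i
    using that prime_p by (metis dvd_add_left_iff dvd_power not_prime_unit)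
  have "t ^ p ^ b * t ^ p ^ c = (t ^ (1 + p ^ (c - b))) ^ p ^ b"
    using assms(2) by (simp only: power_mult[symmetric] power_add[symmetric] distrib_right) simp
  then have "t ^ p ^ b * t ^ p ^ c - t ^ (1 + p ^ (c - b)) \<in> artin_schreier"
    using artin_schreier_frobenius by metis
  then have "t ^ p ^ b * t ^ p ^ c - t * t ^ p ^ a \<in> artin_schreier \<longleftrightarrow>
      t ^ (1 + p ^ (c - b)) - t ^ (1 + p ^ a) \<in> artin_schreier"
    by (intro artin_schreier_cong) simp
  also have "\<dots> \<longleftrightarrow> c - b = a"
  proof
    assume *: "t ^ (1 + p ^ (c - b)) - t ^ (1 + p ^ a) \<in> artin_schreier"
    then have **: "t ^ (1 + p ^ a) - t ^ (1 + p ^ (c - b)) \<in> artin_schreier"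
      using artin_schreier_diff[OF artin_schreier_zero] by fastforce
    show "c - b = a"
    proof (rule linorder_cases)
      assume "c - b < a"
      then have "1 + p ^ (c - b) < 1 + p ^ a" using p_ge_2 by simp
      from t_power_diff_artin_schreier[OF ** this] not_dvd assms(1) show ?thesis by blast
    next
      assume less: "a < c - b"
      then have "1 + p ^ a < 1 + p ^ (c - b)" using p_ge_2 by simp
      from t_power_diff_artin_schreier[OF * this] not_dvd less show ?thesis by fastforce
    qed
  qed (simp add: artin_schreier_zero)
  finally show ?thesis using assms(2) by auto
qed

text \<open>The first condition means \<open>c = a + b\<close> or \<open>b = a + c\<close>, the
  second \<open>c = a + b\<close> or \<open>a = b + c\<close>. The two unwanted alternatives
  together would give \<open>c = 0\<close>.\<close>

lemma add_iff_artin_schreier: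
  assumes "0 < a" "0 < b" "0 < c"
  shows "t ^ p ^ b * t ^ p ^ c - t * t ^ p ^ a \<in> artin_schreier \<and>
      t ^ p ^ a * t ^ p ^ c - t * t ^ p ^ b \<in> artin_schreier \<longleftrightarrow> c = a + b"
proof -
  have "t ^ p ^ j * t ^ p ^ k - t * t ^ p ^ i \<in> artin_schreier \<longleftrightarrow> k = i + j \<or> j = i + k"
    if "0 < i" for i j k
    using shift_iff_artin_schreier[OF that, of j k] shift_iff_artin_schreier[OF that, of k j] that
    by (cases "j \<le> k") (auto simp: mult.commute)
  then show ?thesis using assms by auto
qed

lemma dvd_iff_frobenius:
  assumes "0 < a"
  shows "(\<exists>h. h \<noteq> 0 \<and> h ^ p ^ a * t = h * t ^ p ^ b) \<longleftrightarrow> a dvd b"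
proof
  assume "\<exists>h. h \<noteq> 0 \<and> h ^ p ^ a * t = h * t ^ p ^ b"
  then obtain h where h: "h \<noteq> 0" "h ^ p ^ a * t = h * t ^ p ^ b" by blast
  from arg_cong[OF h(2), of v] have "int p ^ b - 1 = (int p ^ a - 1) * (- v h)"
    using h(1) by (simp add: v_mult v_power t_nonzero v_t algebra_simps)
  then have dvd: "int p ^ a - 1 dvd int p ^ b - 1" by simp
  \<comment> \<open>Modulo \<open>p ^ a - 1\<close>, \<open>p ^ b - 1\<close> reduces to
    \<open>p ^ r - 1\<close>, which is smaller than the modulus and hence 0.\<close>
  define q r where "q = b div a" and "r = b mod a"
  have b: "b = a * q + r" by (simp add: q_def r_def)
  have "int p ^ a - 1 dvd (int p ^ a) ^ q - 1"
    by (metis power_diff_1_eq dvd_triv_left)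
  then have "int p ^ a - 1 dvd (int p ^ b - 1) - ((int p ^ a) ^ q - 1) * int p ^ r"
    using dvd dvd_diff dvd_mult2 by blast
  also have "(int p ^ b - 1) - ((int p ^ a) ^ q - 1) * int p ^ r = int p ^ r - 1"
    by (simp add: b power_add power_mult algebra_simps)
  finally have "int p ^ a - 1 dvd int p ^ r - 1" .
  moreover have "int p ^ r < int p ^ a"
    using assms p_ge_2 by (simp add: r_def)
  moreover have "1 \<le> int p ^ r" using p_ge_2 by (intro one_le_power) simp
  ultimately have "int p ^ r = 1"
    using zdvd_not_zless[of "int p ^ r - 1" "int p ^ a - 1"] by linarith
  then have "r = 0" using p_ge_2 power_inject_exp[of "int p" r 0] by simp
  then show "a dvd b" by (simp add: r_def dvd_eq_mod_eq_0)
next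
  assume "a dvd b"
  then obtain q where b: "b = a * q" by blast
  \<comment> \<open>The geometric sum \<open>(p ^ b - 1) / (p ^ a - 1)\<close>, the pole order that
    valuations force on \<open>h\<close>.\<close>
  define N where "N = (\<Sum>i<q. (p ^ a) ^ i)"
  have "N * p ^ a + 1 = N + p ^ b"
    unfolding N_def b power_mult by (induction q) (simp_all add: algebra_simps)
  then have "(t ^ N) ^ p ^ a * t = t ^ N * t ^ p ^ b"
    by (metis power_add power_mult power_one_right)
  then show "\<exists>h. h \<noteq> 0 \<and> h ^ p ^ a * t = h * t ^ p ^ b"
    using t_nonzero by (intro exI[of _ "t ^ N"]) simp
qed

end

section \<open>Addition and divisibility\<close>

theorem (in simple_pole) definable_add_dvd:
  assumes "definable 1 {[x] | x. \<exists>s::nat. s > 0 \<and> x = t ^ p ^ s}"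
  shows "definable 3 {[t ^ p ^ a, t ^ p ^ b, t ^ p ^ (a + b)] | a b. a > 0 \<and> b > 0}"
    and "definable 2 {[t ^ p ^ a, t ^ p ^ b] | a b. a > 0 \<and> b > 0 \<and> a dvd b}"
proof -
  define D where "D = {[x] | x. \<exists>s::nat. s > 0 \<and> x = t ^ p ^ s}"
  define Add where "Add = (\<lambda>x y z. [x] \<in> D \<and> [y] \<in> D \<and> [z] \<in> D \<and>
    (\<exists>s. y * z - t * x = s ^ p - s) \<and> (\<exists>s. x * z - t * y = s ^ p - s))"
  \<comment> \<open>With \<open>x = t ^ p ^ a\<close>, \<open>Add x g g'\<close> says that
    \<open>g\<close> is some \<open>t ^ p ^ m\<close> with \<open>m > 0\<close> and
    \<open>g'\<close> is \<open>g ^ p ^ a\<close>; this removes the exponent \<open>a\<close> from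
    the formula.\<close>
  define Frob where "Frob = (\<lambda>x u w. \<forall>g g' h h'. Add x g g' \<and> Add x h h' \<longrightarrow>
    (\<exists>s. w * g' * h' - u * g * h = s ^ p - s))"
  define Dvd where "Dvd = (\<lambda>x y. [x] \<in> D \<and> [y] \<in> D \<and>
    (\<exists>h w. h \<noteq> 0 \<and> w * t = h * y \<and> Frob x h w))"
  have dD: "definable_pred (\<lambda>e. [e i] \<in> D)" for i
    unfolding D_def by (rule definable_pred_mem[OF assms])
  have dAdd: "definable_pred (\<lambda>e. Add (e i) (e j) (e k))" for i j k
    unfolding Add_def by (intro definable_intros dD)
  have dDvd: "definable_pred (\<lambda>e. Dvd (e i) (e j))" for i j
    unfolding Dvd_def Frob_def by (intro definable_intros dD dAdd)

  have D: "[x] \<in> D \<longleftrightarrow> (\<exists>s>0. x = t ^ p ^ s)" for x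
    by (simp add: D_def)
  have AS: "(\<exists>s. x = s ^ p - s) \<longleftrightarrow> x \<in> artin_schreier" for x
    by (auto simp: artin_schreier_def)
  have Add: "Add x y z \<longleftrightarrow>
      (\<exists>a b. 0 < a \<and> 0 < b \<and> x = t ^ p ^ a \<and> y = t ^ p ^ b \<and> z = t ^ p ^ (a + b))" for x y z
  proof
    assume "Add x y z"
    then obtain a b c where *: "0 < a" "0 < b" "0 < c" "x = t ^ p ^ a" "y = t ^ p ^ b" "z = t ^ p ^ c"
      unfolding Add_def D by blast
    with \<open>Add x y z\<close> have "c = a + b"
      using add_iff_artin_schreier[of a b c] by (simp add: Add_def AS)
    with * show "\<exists>a b. 0 < a \<and> 0 < b \<and> x = t ^ p ^ a \<and> y = t ^ p ^ b \<and> z = t ^ p ^ (a + b)"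
      by blast
  next
    assume "\<exists>a b. 0 < a \<and> 0 < b \<and> x = t ^ p ^ a \<and> y = t ^ p ^ b \<and> z = t ^ p ^ (a + b)"
    then obtain a b where *: "0 < a" "0 < b" "x = t ^ p ^ a" "y = t ^ p ^ b" "z = t ^ p ^ (a + b)"
      by blast
    then show "Add x y z"
      using add_iff_artin_schreier[of a b "a + b"] unfolding Add_def AS D by blast
  qed
  have Add_iff: "Add (t ^ p ^ a) y z \<longleftrightarrow> (\<exists>b>0. y = t ^ p ^ b \<and> z = t ^ p ^ (a + b))"
    if "0 < a" for a y z
  proof -
    have "t ^ p ^ a = t ^ p ^ a' \<longleftrightarrow> a = a'" for a'
      using inj_t_power by (auto dest: injD)
    then show ?thesis using that unfolding Add by auto
  qed
  have Frob: "Frob (t ^ p ^ a) u w \<longleftrightarrow> w = u ^ p ^ a" if "0 < a" for a u w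
  proof -
    have "Frob (t ^ p ^ a) u w \<longleftrightarrow> (\<forall>m>0. \<forall>n>0.
        w * t ^ p ^ (a + m) * t ^ p ^ (a + n) - u * t ^ p ^ m * t ^ p ^ n \<in> artin_schreier)"
      unfolding Frob_def Add_iff[OF that] AS by blast
    then show ?thesis unfolding frobenius_iff_artin_schreier .
  qed
  have Dvd: "Dvd x y \<longleftrightarrow> (\<exists>a b. 0 < a \<and> 0 < b \<and> a dvd b \<and> x = t ^ p ^ a \<and> y = t ^ p ^ b)" for x y
  proof -
    have "(\<exists>h w. h \<noteq> 0 \<and> w * t = h * t ^ p ^ b \<and> Frob (t ^ p ^ a) h w) \<longleftrightarrow> a dvd b"
      if "0 < a" for a b
      using dvd_iff_frobenius[OF that] by (simp add: Frob[OF that])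
    then show ?thesis unfolding Dvd_def D by blast
  qed

  have length_3: "length xs = 3 \<longleftrightarrow> (\<exists>x y z. xs = [x, y, z])"
    and length_2: "length xs = 2 \<longleftrightarrow> (\<exists>x y. xs = [x, y])" for xs :: "'k list"
    by (auto simp: numeral_eq_Suc length_Suc_conv)
  show "definable 3 {[t ^ p ^ a, t ^ p ^ b, t ^ p ^ (a + b)] | a b. a > 0 \<and> b > 0}"
    by (rule definableI[OF dAdd[of 0 1 2]]) (auto simp: length_3 list_env_def Add; blast)
  show "definable 2 {[t ^ p ^ a, t ^ p ^ b] | a b. a > 0 \<and> b > 0 \<and> a dvd b}"
    by (rule definableI[OF dDvd[of 0 1]]) (auto simp: length_2 list_env_def Dvd; blast)
qed

theorem theorem2p7:
  fixes F :: "'k::field set" and t :: 'k and p :: nat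
  assumes "CHAR('k) = p" and "p > 0"
    and "function_field_one_var F"
    and "algebraically_closed_in F"
    and "t \<notin> F"
    and "\<not> (\<exists>y. t = y ^ p)"
    and "\<exists>v. prime_valuation F v \<and> (v t = 1 \<or> v t = -1)"
    and "definable 1 {[x] | x. \<exists>s::nat. s > 0 \<and> x = t ^ (p ^ s)}"
  shows "has_model_Zpos_add_dvd TYPE('k) \<and>
         bij_betw (\<lambda>s. t ^ (p ^ s)) {s::nat. s > 0} {x. \<exists>s::nat. s > 0 \<and> x = t ^ (p ^ s)} \<and>
         definable 3 {[t ^ (p ^ a), t ^ (p ^ b), t ^ (p ^ (a + b))] | a b. a > 0 \<and> b > 0} \<and>
         definable 2 {[t ^ (p ^ a), t ^ (p ^ b)] | a b. a > 0 \<and> b > 0 \<and> a dvd b}"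
proof -
  have "prime p" using prime_CHAR_semidom[where 'a = 'k] assms(1,2) by simp
  have t0: "t \<noteq> 0"
    using assms(3,5) by (auto simp: function_field_one_var_def subfield_def)
  obtain v where v: "prime_valuation F v" "v t = 1 \<or> v t = -1"
    using assms(7) by blast
  have pole: "simple_pole v x p" if "x \<noteq> 0" "v x = - 1" for x
    using v(1) that assms(1) \<open>prime p\<close> by unfold_locales (auto simp: prime_valuation_def)
  have "inj (\<lambda>s. t ^ p ^ s) \<and>
    definable 3 {[t ^ (p ^ a), t ^ (p ^ b), t ^ (p ^ (a + b))] | a b. a > 0 \<and> b > 0} \<and>
    definable 2 {[t ^ (p ^ a), t ^ (p ^ b)] | a b. a > 0 \<and> b > 0 \<and> a dvd b}"
  proof (cases "v t = - 1")
    case True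
    interpret simple_pole v t p using pole t0 True .
    show ?thesis using inj_t_power definable_add_dvd assms(8) by blast
  next
    case False
    have "v 1 = 0" using v(1) by (metis mult_1 add_cancel_right_right prime_valuation_def zero_neq_one)
    moreover have "v (t * inverse t) = v t + v (inverse t)"
      using v(1) t0 unfolding prime_valuation_def by (metis nonzero_imp_inverse_nonzero)
    ultimately have "v (inverse t) = - 1" using v(2) False t0 by simp
    \<comment> \<open>Here \<open>t\<close> has a simple zero. The hypothesis is carried to
      \<open>inverse t\<close> by coordinatewise inversion, and the resulting graphs are carried
      back the same way.\<close>
    then interpret simple_pole v "inverse t" p using pole[of "inverse t"] t0 by simp
    have inverse_eq: "inverse x = y \<longleftrightarrow> x = inverse y" for x y :: 'k by auto
    have eq1: "{xs. map inverse xs \<in> {[x] | x. \<exists>s::nat. s > 0 \<and> x = t ^ (p ^ s)}}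
        = {[x] | x. \<exists>s::nat. s > 0 \<and> x = inverse t ^ (p ^ s)}"
      by (auto simp: map_eq_Cons_conv power_inverse inverse_eq; blast)
    have eq2: "{xs. map inverse xs \<in> {[inverse t ^ (p ^ a), inverse t ^ (p ^ b)] | a b.
         a > 0 \<and> b > 0 \<and> a dvd b}}
       = {[t ^ (p ^ a), t ^ (p ^ b)] | a b. a > 0 \<and> b > 0 \<and> a dvd b}"
      by (auto simp: map_eq_Cons_conv power_inverse inverse_eq; blast)
    have eq3: "{xs. map inverse xs \<in> {[inverse t ^ (p ^ a), inverse t ^ (p ^ b),
        inverse t ^ (p ^ (a + b))] | a b. a > 0 \<and> b > 0}}
       = {[t ^ (p ^ a), t ^ (p ^ b), t ^ (p ^ (a + b))] | a b. a > 0 \<and> b > 0}"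
      by (auto simp: map_eq_Cons_conv power_inverse inverse_eq; blast)
    note def = definable_add_dvd[OF definable_inverse[OF assms(8), unfolded eq1]]
    show ?thesis
      using inj_t_power definable_inverse[OF def(1)] definable_inverse[OF def(2)]
      unfolding eq2 eq3 by (simp add: power_inverse inj_def)
  qed
  then have inj: "inj (\<lambda>s. t ^ p ^ s)"
    and add: "definable 3 {[t ^ (p ^ a), t ^ (p ^ b), t ^ (p ^ (a + b))] | a b. a > 0 \<and> b > 0}"
    and dvd: "definable 2 {[t ^ (p ^ a), t ^ (p ^ b)] | a b. a > 0 \<and> b > 0 \<and> a dvd b}"
    by blast+
  have "bij_betw (\<lambda>s. t ^ (p ^ s)) {s::nat. s > 0} {x. \<exists>s::nat. s > 0 \<and> x = t ^ (p ^ s)}"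
    using inj by (auto simp: bij_betw_def intro: inj_on_subset)
  moreover have "bij_betw (\<lambda>s. [t ^ (p ^ s)]) {s::nat. s > 0}
      {[x] | x. \<exists>s::nat. s > 0 \<and> x = t ^ (p ^ s)}"
    using inj by (auto simp: bij_betw_def inj_on_def)
  then have "has_model_Zpos_add_dvd TYPE('k)"
    unfolding has_model_Zpos_add_dvd_def using assms(8) add dvd
    by (intro exI[of _ 1] exI[of _ "\<lambda>s. [t ^ p ^ s]"]
        exI[of _ "{[x] | x. \<exists>s::nat. s > 0 \<and> x = t ^ (p ^ s)}"] conjI) simp_all
  ultimately show ?thesis using add dvd by blast
qed

end
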